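(* Let $k\ge2$ be an integer, $a>0$, and $r>0$. Let $S_{k,a}$ be the metric star with $k$ arms, each of length $a$. There is a probability measure $\nu$ on $\mathcal C(S_{k,a},0)$ such that $E_\nu\le\frac{ka}{r}\,U[0,r]$ if and only if $0<r\le(k-1)a$.
   Context: $S_{k,a}$ is the metric tree obtained by gluing $k$ intervals of length $a$ at a common endpoint; its total length is $|S_{k,a}|=ka$. For a finite metric tree $T$ (metric realization of a finite combinatorial tree with positive edge lengths), $|T|$ is the total edge length, $d_T$ the path metric, and $B_T(v,s)=\{x\in T: d_T(x,v)\le s\}$. For $m\ge1$, a tuple $\mathbf r=(r_1,\dots,r_m)\in\mathbb R_{\ge0}^m$ is a cover of $T$ if there are $v_1,\dots,v_m\in T$ with $T\subseteq\bigcup_i B_T(v_i,r_i)$; $\mathcal C_m(T)$ is the set of such tuples, $\mathcal C(T)=\bigsqcup_{m\ge1}\mathcal C_m(T)$ with the disjoint-union Borel structure, and $\mathcal C(T,0)=\{\mathbf r\in\mathcal C(T):\sum_i r_i\le|T|\}$. For a finite Borel measure $\nu$ on $\mathcal C(T)$, $E_\nu(A)=\int|\{i:r_i\in A\}|\,d\nu(\mathbf r)$ for Borel $A\subseteq\mathbb R_{\ge0}$. For positive Borel measures, $\mu\le\mu'$ means $\mu(A)\le\mu'(A)$ for all Borel $A$. $U[0,r]$ is the uniform probability measure on $[0,r]$, viewed as a measure on $\mathbb R_{\ge0}$. *)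

theory Defs
  imports "HOL-Probability.Probability"
begin

text \<open>
  The star: \<open>(i, x)\<close> is the point of arm \<open>i\<close> at distance \<open>x\<close> from the common endpoint.
  The identification of the points \<open>(i, 0)\<close> is made by keeping only the representative
  \<open>(0, 0)\<close>. The absolute values in the distance are void on the carrier; they are there
  because the locale of metric spaces asks for nonnegativity on the whole type.
\<close>

definition star_points :: "nat \<Rightarrow> real \<Rightarrow> (nat \<times> real) set" where
  "star_points k a = insert (0, 0) ({..<k} \<times> {0<..a})"

definition star_dist :: "nat \<times> real \<Rightarrow> nat \<times> real \<Rightarrow> real" where
  "star_dist p q =
     (if fst p = fst q then \<bar>snd p - snd q\<bar> else \<bar>snd p\<bar> + \<bar>snd q\<bar>)"

definition star :: "nat \<Rightarrow> real \<Rightarrow> (nat \<times> real) metric" where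
  "star k a = metric (star_points k a, star_dist)"

text \<open>Total edge length: the sum over the arms of their lengths.\<close>

definition star_length :: "nat \<Rightarrow> real \<Rightarrow> real" where
  "star_length k a = (\<Sum>i<k. a)"

lemma Metric_space_star: "Metric_space (star_points k a) star_dist"
proof
  fix p q s :: "nat \<times> real"
  show "0 \<le> star_dist p q" "star_dist p q = star_dist q p"
    by (auto simp: star_dist_def)
  show "star_dist p q = 0 \<longleftrightarrow> p = q" if "p \<in> star_points k a" "q \<in> star_points k a"
    using that by (auto simp: star_dist_def star_points_def)
  show "star_dist p s \<le> star_dist p q + star_dist q s"
    by (auto simp: star_dist_def)
qed

lemma mspace_star [simp]: "mspace (star k a) = star_points k a"
  and mdist_star [simp]: "mdist (star k a) = star_dist"
  unfolding star_def
  by (rule Metric_space.mspace_metric Metric_space.mdist_metric, rule Metric_space_star)+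

lemma star_length_eq: "star_length k a = real k * a"
  by (simp add: star_length_def)

text \<open>
  A tuple of length \<open>m\<close> is an extensional function on \<open>{..<m}\<close>; in the disjoint union over
  \<open>m \<ge> 1\<close> it is tagged with its length.
\<close>

definition covers_of_length :: "'a metric \<Rightarrow> nat \<Rightarrow> (nat \<Rightarrow> real) set" where
  "covers_of_length T m =
     {r \<in> {..<m} \<rightarrow>\<^sub>E {0..}.
        \<exists>v \<in> {..<m} \<rightarrow> mspace T. mspace T \<subseteq> (\<Union>i<m. mcball_of T (v i) (r i))}"

definition covers :: "'a metric \<Rightarrow> (nat \<times> (nat \<Rightarrow> real)) set" where
  "covers T = (SIGMA m:{1..}. covers_of_length T m)"

text \<open>\<open>L\<close> is the total length of \<open>T\<close>.\<close>

definition short_covers :: "'a metric \<Rightarrow> real \<Rightarrow> (nat \<times> (nat \<Rightarrow> real)) set" where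
  "short_covers T L = {(m, r) \<in> covers T. (\<Sum>i<m. r i) \<le> L}"

text \<open>
  The disjoint union over \<open>m \<ge> 1\<close> of the Borel spaces of \<open>m\<close>-tuples of nonnegative reals. Sets of
  covers carry the trace of this structure.
\<close>

definition tuple_space :: "(nat \<times> (nat \<Rightarrow> real)) measure" where
  "tuple_space = sigma (SIGMA m:{1..}. {..<m} \<rightarrow>\<^sub>E {0..})
     {A. A \<subseteq> (SIGMA m:{1..}. {..<m} \<rightarrow>\<^sub>E {0..}) \<and>
         (\<forall>m\<ge>1. {r. (m, r) \<in> A} \<in> sets (Pi\<^sub>M {..<m} (\<lambda>_. restrict_space borel {0..})))}"

lemma space_tuple_space: "space tuple_space = (SIGMA m:{1..}. {..<m} \<rightarrow>\<^sub>E {0..})"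
  by (simp add: tuple_space_def space_measure_of_conv)

lemma sets_tuple_space:
  "sets tuple_space =
     {A. A \<subseteq> (SIGMA m:{1..}. {..<m} \<rightarrow>\<^sub>E {0..}) \<and>
         (\<forall>m\<ge>1. {r. (m, r) \<in> A} \<in> sets (Pi\<^sub>M {..<m} (\<lambda>_. restrict_space borel {0..})))}"
  (is "_ = ?S")
proof -
  let ?O = "SIGMA m:{1..}. {..<m} \<rightarrow>\<^sub>E {0::real..}"
  let ?P = "\<lambda>m::nat. Pi\<^sub>M {..<m} (\<lambda>_. restrict_space borel {0::real..})"
  have "sigma_algebra ?O ?S"
    unfolding sigma_algebra_iff2
  proof (intro conjI ballI allI impI)
    fix A assume A: "A \<in> ?S"
    have "{r. (m, r) \<in> ?O - A} = space (?P m) - {r. (m, r) \<in> A}" if "m \<ge> 1" for m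
      using that by (auto simp: space_PiM space_restrict_space)
    with A show "?O - A \<in> ?S" by auto
  next
    fix F :: "nat \<Rightarrow> (nat \<times> (nat \<Rightarrow> real)) set" assume F: "range F \<subseteq> ?S"
    have "{r. (m, r) \<in> (\<Union>i. F i)} = (\<Union>i. {r. (m, r) \<in> F i})" for m by auto
    moreover have "(\<Union>i. {r. (m, r) \<in> F i}) \<in> sets (?P m)" if "m \<ge> 1" for m
      using F that by (intro sets.countable_UN) blast
    moreover have "(\<Union>i. F i) \<subseteq> ?O"
      using F by blast
    ultimately show "(\<Union>i. F i) \<in> ?S" by simp
  qed auto
  then show ?thesis
    by (simp add: tuple_space_def sigma_algebra.sets_measure_of_eq)
qed

text \<open>The measure \<open>E\<^sub>\<nu>\<close>, as a set function on the Borel sets of nonnegative reals.\<close>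

definition expected_radii ::
  "(nat \<times> (nat \<Rightarrow> real)) measure \<Rightarrow> real set \<Rightarrow> ennreal" where
  "expected_radii \<nu> A = (\<integral>\<^sup>+ (m, r). of_nat (card {i. i < m \<and> r i \<in> A}) \<partial>\<nu>)"

end

theory Submission
  imports Defs
begin

text \<open>
  Write \<open>D = k a / r\<^sup>2\<close> for the constant density of the bound \<open>(k a / r) U[0,r]\<close>.

  Necessity. A ball of radius less than \<open>a\<close> contains at most one of the \<open>k\<close> leaves, so a cover has
  a radius that is at least \<open>a\<close>, or else at least \<open>k\<close> radii below \<open>a\<close>. In both cases \<open>k\<close> times the
  number of large radii plus the number of small ones is at least \<open>k\<close> (\<open>many_radii\<close>). For \<open>r > a\<close>,
  taking expectations gives \<open>k \<le> k D (r - a) + D a\<close>, which simplifies to \<open>r + a \<le> k a\<close>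
  (\<open>radius_bound_necessary\<close>).

  Sufficiency. Suppose a random list of radii \<open>e\<^sub>0(y), e\<^sub>1(y), \<dots>\<close>, with \<open>y\<close> uniform on \<open>[0,1]\<close>, is
  such that the radii of \<open>e(y)\<close> and of \<open>e(1 - y)\<close> together sum to \<open>a\<close>. On an interval of length \<open>2 a\<close>
  the two lists, laid out as consecutive balls from the two ends, form a cover without overlap;
  suppose also that every ball keeps its centre in its own half.
  Folding the star onto this interval, half of the arms on either side, turns it into a cover of the
  star: every arm receives \<open>e(y)\<close> or \<open>e(1 - y)\<close> according to its parity, and the list that
  reaches across the centre serves all the arms of the other parity at once
  (\<open>arm_radii_short_cover\<close>). As \<open>1 - y\<close> is also uniform, every arm contributes the same to
  the expected radii.

  For \<open>r \<le> a\<close> write \<open>a = (n + \<theta>) r\<close> with an integer \<open>n \<ge> 1\<close> and \<open>0 \<le> \<theta> < 1\<close>. With probability \<open>\<theta>\<close> the list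
  consists of \<open>\<theta> r y\<close> followed by \<open>n\<close> alternating radii \<open>r (1 - y), r y, \<dots>\<close>; with probability
  \<open>1 - \<theta>\<close> it consists of \<open>\<theta> r + (1 - \<theta>) r y\<close> followed by \<open>n - 1\<close> alternating radii. The first radius
  is then uniform on \<open>[0, \<theta> r]\<close> with probability \<open>\<theta>\<close> and on \<open>[\<theta> r, r]\<close> with probability \<open>1 - \<theta>\<close>,
  hence uniform on \<open>[0,r]\<close>, and so is each of the others. The expected number of radii is
  \<open>n + \<theta> = a / r\<close> per arm, so the bound holds with equality (\<open>exists_small_radii\<close>).

  For \<open>a < r \<le> (k - 1) a\<close>, one ball at the centre, of radius uniform on \<open>[a,r]\<close>, is used with
  probability \<open>p = min 1 (D (r - a))\<close>, and otherwise the folded cover whose list is the single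
  radius \<open>a y\<close>. The hypothesis on \<open>r\<close> is what keeps the density \<open>(1 - p) k / a\<close> of the
  radii below \<open>a\<close> under \<open>D\<close> (\<open>exists_large_radii\<close>).
\<close>

section \<open>Covers of the star folded from an interval\<close>

text \<open>Balls of radii \<open>e 0, e 1, \<dots>\<close> are laid out side by side, from \<open>a\<close> downwards.\<close>

lemma prefix_intervals_cover:
  fixes e :: "nat \<Rightarrow> real"
  assumes "a - 2 * (\<Sum>j<M. e j) \<le> t" "t \<le> a" "0 < M"
  shows "\<exists>j<M. \<bar>t - (a - 2 * (\<Sum>l<j. e l) - e j)\<bar> \<le> e j"
  using assms
proof (induction M)
  case (Suc M)
  show ?case
  proof (cases "a - 2 * (\<Sum>j<M. e j) \<le> t \<and> 0 < M")
    case True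
    then show ?thesis using Suc less_SucI by blast
  next
    case False
    then have "t \<le> a - 2 * (\<Sum>j<M. e j)"
      using Suc.prems by (cases M) auto
    then have "\<bar>t - (a - 2 * (\<Sum>l<M. e l) - e M)\<bar> \<le> e M"
      using Suc.prems by (simp add: abs_le_iff)
    then show ?thesis by blast
  qed
qed simp

lemma sum_lessThan_mult_div_mod:
  "(\<Sum>i<k * M. h (i div M) (i mod M)) = (\<Sum>q<k. \<Sum>j<(M::nat). h q j)"
proof -
  have "(\<Sum>i = q * M..<q * M + M. h (i div M) (i mod M)) = (\<Sum>j<M. h q j)" for q
  proof -
    have "(\<Sum>i = q * M..<q * M + M. h (i div M) (i mod M)) =
        (\<Sum>j = 0..<M. h ((j + q * M) div M) ((j + q * M) mod M))"
      using sum.shift_bounds_nat_ivl[of "\<lambda>i. h (i div M) (i mod M)" 0 "q * M" M]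
      by (simp add: add.commute)
    also have "\<dots> = (\<Sum>j = 0..<M. h q j)"
      by (intro sum.cong) auto
    finally show ?thesis by (simp add: atLeast0LessThan)
  qed
  then show ?thesis
    by (simp add: sum.nat_group[symmetric])
qed

text \<open>
  Arm \<open>q\<close> owns the indices \<open>q M, \<dots>, q M + M - 1\<close>. Alternating between \<open>y\<close> and \<open>1 - y\<close> over the arms
  is the folding map onto an interval; any rule that uses both values would do for covering.
\<close>

definition arm_radii :: "nat \<Rightarrow> (nat \<Rightarrow> real \<Rightarrow> real) \<Rightarrow> nat \<Rightarrow> real \<Rightarrow> real" where
  "arm_radii M e i y = e (i mod M) (if even (i div M) then y else 1 - y)"

text \<open>
  The balls of an arm are laid out from its leaf inwards, and the second assumption on \<open>e\<close> says
  that their centres do stay in the arm. A point that its own arm leaves uncovered lies at a distance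
  of less than \<open>a - 2 \<Sigma>\<close> from the centre, where \<open>\<Sigma>\<close> is the sum of the radii of the arm. On an arm of the
  other parity the radii sum to \<open>a - \<Sigma>\<close>, so its last ball reaches \<open>a - 2 \<Sigma>\<close> beyond the centre
  into every other arm.
\<close>

lemma arm_radii_short_cover:
  fixes e :: "nat \<Rightarrow> real \<Rightarrow> real"
  assumes "2 \<le> k" "0 < a" "0 < M" and y: "y \<in> {0..1}"
    and nonneg: "\<And>j z. j < M \<Longrightarrow> z \<in> {0..1} \<Longrightarrow> 0 \<le> e j z"
    and centre: "\<And>j z. j < M \<Longrightarrow> z \<in> {0..1} \<Longrightarrow> 0 \<le> a - 2 * (\<Sum>l<j. e l z) - e j z"
    and total: "\<And>z. z \<in> {0..1} \<Longrightarrow> (\<Sum>j<M. e j z) + (\<Sum>j<M. e j (1 - z)) = a"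
  shows "(k * M, \<lambda>i\<in>{..<k * M}. arm_radii M e i y) \<in> short_covers (star k a) (star_length k a)"
proof -
  let ?rad = "\<lambda>i\<in>{..<k * M}. arm_radii M e i y"
  define z where "z q = (if even q then y else 1 - y)" for q :: nat
  define c where "c q j = a - 2 * (\<Sum>l<j. e l (z q)) - e j (z q)" for q j
  (* The centre of the star is represented only by (0, 0), whatever arm it is reached from. *)
  define pt where "pt q x = (if x = 0 then (0, 0) else (q, x))" for q :: nat and x :: real
  define v where "v i = pt (i div M) (c (i div M) (i mod M))" for i
  have z: "z q \<in> {0..1}" for q using y by (auto simp: z_def)
  have c_nonneg: "0 \<le> c q j" if "j < M" for q j
    using centre[OF that z] by (simp add: c_def)
  have e_nonneg: "0 \<le> e j (z q)" if "j < M" for q j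
    using nonneg[OF that z] .
  have sums_nonneg: "0 \<le> (\<Sum>l<j. e l (z q))" if "j \<le> M" for q j
    using that by (intro sum_nonneg e_nonneg) auto
  have c_le: "c q j \<le> a" if "j < M" for q j
    using sums_nonneg[of j q] e_nonneg[OF that, of q] that unfolding c_def by simp
  have flip: "(\<Sum>j<M. e j (z q)) + (\<Sum>j<M. e j (z q')) = a" if "even q \<noteq> even q'" for q q'
    using total[OF y] that by (auto simp: z_def)
  have index: "q * M + j < k * M" if "q < k" "j < M" for q j
  proof -
    have "q * M + j < (q + 1) * M" using that by simp
    also have "\<dots> \<le> k * M" using that by (intro mult_right_mono) auto
    finally show ?thesis .
  qed
  have rad_index: "?rad (q * M + j) = e j (z q)" and v_index: "v (q * M + j) = pt q (c q j)"
    if "q < k" "j < M" for q j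
    using index[OF that] that by (simp_all add: arm_radii_def z_def v_def)
  have div_mod: "i div M < k" "i mod M < M" if "i < k * M" for i
    using that \<open>0 < M\<close> by (simp_all add: less_mult_imp_div_less)
  have v_in: "v i \<in> star_points k a" if "i < k * M" for i
    using div_mod[OF that] c_nonneg[of "i mod M" "i div M"] c_le[of "i mod M" "i div M"]
    by (auto simp: v_def pt_def star_points_def)
  have covered: "\<exists>i<k * M. star_dist (v i) (q, t) \<le> ?rad i"
    if "q < k" "0 \<le> t" "t \<le> a" for q t
  proof (cases "a - 2 * (\<Sum>j<M. e j (z q)) \<le> t")
    case True
    from prefix_intervals_cover[OF this \<open>t \<le> a\<close> \<open>0 < M\<close>]
    obtain j where j: "j < M" "\<bar>t - c q j\<bar> \<le> e j (z q)" unfolding c_def by auto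
    then have "star_dist (v (q * M + j)) (q, t) \<le> ?rad (q * M + j)"
      unfolding rad_index[OF \<open>q < k\<close> j(1)] v_index[OF \<open>q < k\<close> j(1)]
      using that by (auto simp: star_dist_def pt_def)
    then show ?thesis using index[OF \<open>q < k\<close> j(1)] by blast
  next
    case False
    define q' :: nat where "q' = (if even q then 1 else 0)"
    have q': "q' < k" "even q \<noteq> even q'" using \<open>2 \<le> k\<close> by (auto simp: q'_def)
    define j where "j = M - 1"
    have j: "j < M" "M = Suc j" using \<open>0 < M\<close> by (auto simp: j_def)
    have "c q' j + t \<le> e j (z q')"
      using False flip[OF q'(2)] unfolding c_def j(2) by simp
    then have "star_dist (v (q' * M + j)) (q, t) \<le> ?rad (q' * M + j)"
      unfolding rad_index[OF q'(1) j(1)] v_index[OF q'(1) j(1)]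
      using that c_nonneg[OF j(1), of q'] by (auto simp: star_dist_def pt_def)
    then show ?thesis using index[OF q'(1) j(1)] by blast
  qed
  have "star_points k a \<subseteq> (\<Union>i<k * M. mcball_of (star k a) (v i) (?rad i))"
  proof
    fix p assume p: "p \<in> star_points k a"
    then obtain q t where qt: "p = (q, t)" "q < k" "0 \<le> t" "t \<le> a"
      using \<open>2 \<le> k\<close> \<open>0 < a\<close> by (auto simp: star_points_def)
    from covered[OF qt(2-4)] obtain i where "i < k * M" "star_dist (v i) p \<le> ?rad i"
      unfolding qt(1) by blast
    then show "p \<in> (\<Union>i<k * M. mcball_of (star k a) (v i) (?rad i))"
      using p v_in by auto
  qed
  moreover have rad_nonneg: "?rad i \<in> {0..}" if "i < k * M" for i
    using div_mod[OF that] that e_nonneg[of "i mod M" "i div M"] by (simp add: arm_radii_def z_def)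
  moreover have "1 \<le> k * M" using \<open>2 \<le> k\<close> \<open>0 < M\<close> by simp
  ultimately have cover: "(k * M, ?rad) \<in> covers (star k a)"
    unfolding covers_def covers_of_length_def using v_in
    by (auto intro!: exI[of _ v] bexI[of _ v])
  have "(\<Sum>i<k * M. ?rad i) = (\<Sum>i<k * M. e (i mod M) (z (i div M)))"
    by (intro sum.cong) (auto simp: arm_radii_def z_def)
  also have "\<dots> = (\<Sum>q<k. \<Sum>j<M. e j (z q))"
    by (rule sum_lessThan_mult_div_mod)
  also have "\<dots> \<le> (\<Sum>q<k. a)"
  proof (intro sum_mono)
    fix q
    show "(\<Sum>j<M. e j (z q)) \<le> a"
      using flip[of q "Suc q"] sums_nonneg[of M "Suc q"] by simp
  qed
  finally show ?thesis
    using cover by (simp add: short_covers_def star_length_def)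
qed

section \<open>Laws of the radii\<close>

text \<open>
  The slope multiplies the probability instead of dividing the length, so that the degenerate
  case \<open>c = 0\<close> is included; it occurs when \<open>a\<close> is a multiple of \<open>r\<close>.
\<close>

lemma measure_affine_preimage:
  fixes A :: "real set"
  assumes [measurable]: "A \<in> sets borel" and "0 \<le> c"
  shows "c * measure lborel {y \<in> {0..1}. s + c * y \<in> A} = measure lborel (A \<inter> {s..s + c})"
proof (cases "c = 0")
  case True
  have "emeasure lborel (A \<inter> {s}) \<le> emeasure lborel {s}"
    by (intro emeasure_mono) auto
  then show ?thesis using True by (simp add: measure_def)
next
  case False
  with \<open>0 \<le> c\<close> have "0 < c" by simp
  have "emeasure lborel (A \<inter> {s..s + c}) = (\<integral>\<^sup>+x. indicator (A \<inter> {s..s + c}) x \<partial>lborel)"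
    by (subst nn_integral_indicator) auto
  also have "\<dots> = ennreal c * (\<integral>\<^sup>+x. indicator (A \<inter> {s..s + c}) (s + c * x) \<partial>lborel)"
    using \<open>0 < c\<close> by (subst nn_integral_real_affine[where c = c and t = s]) auto
  also have "(\<integral>\<^sup>+x. indicator (A \<inter> {s..s + c}) (s + c * x) \<partial>lborel) =
      (\<integral>\<^sup>+x. indicator {y \<in> {0..1}. s + c * y \<in> A} x \<partial>lborel)"
    using \<open>0 < c\<close>
    by (intro nn_integral_cong) (auto simp: indicator_def mult_le_cancel_left1 zero_le_mult_iff)
  also have "\<dots> = emeasure lborel {y \<in> {0..1}. s + c * y \<in> A}"
    by (subst nn_integral_indicator) auto
  finally show ?thesis
    using \<open>0 \<le> c\<close> by (simp add: measure_def enn2real_mult)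
qed

lemma measure_reflect_preimage:
  fixes h :: "real \<Rightarrow> real"
  assumes [measurable]: "h \<in> borel_measurable borel" "A \<in> sets borel"
  shows "measure lborel {y \<in> {0..1}. h (1 - y) \<in> A} = measure lborel {y \<in> {0..1}. h y \<in> A}"
proof -
  have "emeasure lborel {y \<in> {0..1}. h y \<in> A} =
      (\<integral>\<^sup>+x. indicator {y \<in> {0..1}. h y \<in> A} x \<partial>lborel)"
    by (subst nn_integral_indicator) auto
  also have "\<dots> = (\<integral>\<^sup>+x. indicator {y \<in> {0..1}. h y \<in> A} (1 - x) \<partial>lborel)"
    by (subst nn_integral_real_affine[where c = "-1" and t = 1]) auto
  also have "\<dots> = (\<integral>\<^sup>+x. indicator {y \<in> {0..1}. h (1 - y) \<in> A} x \<partial>lborel)"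
    by (intro nn_integral_cong) (auto simp: indicator_def)
  also have "\<dots> = emeasure lborel {y \<in> {0..1}. h (1 - y) \<in> A}"
    by (subst nn_integral_indicator) auto
  finally show ?thesis by (simp add: measure_def)
qed

lemma measure_Int_split:
  fixes A :: "real set"
  assumes [measurable]: "A \<in> sets borel" and "s \<le> t" "t \<le> u"
  shows "measure lborel (A \<inter> {s..t}) + measure lborel (A \<inter> {t..u}) = measure lborel (A \<inter> {s..u})"
proof -
  have fin: "A \<inter> {x..y} \<in> fmeasurable lborel" for x y
    by (rule fmeasurableI2[of "{x..y}"]) (auto simp: fmeasurable_def emeasure_lborel_Icc_eq)
  have "measure lborel (A \<inter> {s..t} \<union> A \<inter> {t..u}) =
      measure lborel (A \<inter> {s..t}) + measure lborel (A \<inter> {t..u})"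
    using AE_lborel_singleton[of t] fin by (intro measure_Un_AE) (auto elim!: eventually_mono)
  moreover have "A \<inter> {s..t} \<union> A \<inter> {t..u} = A \<inter> {s..u}"
    using assms(2,3) by auto
  ultimately show ?thesis by simp
qed

lemma arm_radii_law:
  assumes [measurable]: "\<And>j. e j \<in> borel_measurable borel" "A \<in> sets borel"
  shows "(\<Sum>i<k * M. measure lborel {y \<in> {0..1}. arm_radii M e i y \<in> A}) =
    k * (\<Sum>j<M. measure lborel {y \<in> {0..1}. e j y \<in> A})"
proof -
  have "measure lborel {y \<in> {0..1}. arm_radii M e i y \<in> A} =
      measure lborel {y \<in> {0..1}. e (i mod M) y \<in> A}" for i
    using measure_reflect_preimage[of "e (i mod M)" A]
    by (cases "even (i div M)") (simp_all add: arm_radii_def)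
  then have "(\<Sum>i<k * M. measure lborel {y \<in> {0..1}. arm_radii M e i y \<in> A}) =
      (\<Sum>i<k * M. measure lborel {y \<in> {0..1}. e (i mod M) y \<in> A})"
    by simp
  also have "\<dots> = (\<Sum>q<k. \<Sum>j<M. measure lborel {y \<in> {0..1}. e j y \<in> A})"
    by (rule sum_lessThan_mult_div_mod)
  finally show ?thesis by simp
qed

section \<open>Random covers\<close>

lemma card_eq_sum_indicator:
  fixes m :: nat
  shows "of_nat (card {i. i < m \<and> \<rho> i \<in> A}) = (\<Sum>i<m. indicator A (\<rho> i) :: 'b::semiring_1)"
proof -
  have "(\<Sum>i<m. indicator A (\<rho> i)) = (\<Sum>i | i < m \<and> \<rho> i \<in> A. 1 :: 'b)"
    by (intro sum.mono_neutral_cong_right) auto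
  then show ?thesis by simp
qed

lemma measurable_Pair_tuple_space:
  assumes "1 \<le> m"
  shows "Pair m \<in> measurable (Pi\<^sub>M {..<m} (\<lambda>_. restrict_space borel {0..})) tuple_space"
proof (rule measurableI)
  fix B assume B: "B \<in> sets tuple_space"
  then have "Pair m -` B \<inter> space (Pi\<^sub>M {..<m} (\<lambda>_. restrict_space borel {0..})) = {\<rho>. (m, \<rho>) \<in> B}"
    by (auto simp: sets_tuple_space space_PiM space_restrict_space)
  then show "Pair m -` B \<inter> space (Pi\<^sub>M {..<m} (\<lambda>_. restrict_space borel {0..}))
      \<in> sets (Pi\<^sub>M {..<m} (\<lambda>_. restrict_space borel {0..}))"
    using B assms by (simp add: sets_tuple_space)
qed (use assms in \<open>auto simp: space_tuple_space space_PiM space_restrict_space\<close>)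

lemma measurable_tuple_spaceI:
  assumes "\<And>m. 1 \<le> m \<Longrightarrow>
    (\<lambda>\<rho>. f (m, \<rho>)) \<in> measurable (Pi\<^sub>M {..<m} (\<lambda>_. restrict_space borel {0..})) N"
  shows "f \<in> measurable tuple_space N"
proof (rule measurableI)
  fix w assume "w \<in> space tuple_space"
  then obtain m \<rho> where "w = (m, \<rho>)" "1 \<le> m" "\<rho> \<in> {..<m} \<rightarrow>\<^sub>E {0..}"
    by (auto simp: space_tuple_space)
  then show "f w \<in> space N"
    using measurable_space[OF assms] by (simp add: space_PiM space_restrict_space)
next
  fix B assume B: "B \<in> sets N"
  have "{\<rho>. (m, \<rho>) \<in> f -` B \<inter> space tuple_space} =
      (\<lambda>\<rho>. f (m, \<rho>)) -` B \<inter> space (Pi\<^sub>M {..<m} (\<lambda>_. restrict_space borel {0..}))" if "1 \<le> m" for m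
    using that by (auto simp: space_tuple_space space_PiM space_restrict_space)
  then show "f -` B \<inter> space tuple_space \<in> sets tuple_space"
    using measurable_sets[OF assms B] by (auto simp: sets_tuple_space space_tuple_space)
qed

lemma measurable_radii_count:
  assumes [measurable]: "A \<in> sets borel"
  shows "(\<lambda>(m, \<rho>). of_nat (card {i. i < m \<and> \<rho> i \<in> A}) :: ennreal) \<in> borel_measurable tuple_space"
proof (rule measurable_tuple_spaceI)
  fix m :: nat
  have [measurable]: "(\<lambda>\<rho>. \<rho> i) \<in> borel_measurable (Pi\<^sub>M {..<m} (\<lambda>_. restrict_space borel {0::real..}))"
    if "i \<in> {..<m}" for i
    using measurable_component_singleton[OF that]
    by (rule measurable_compose) (simp add: measurable_restrict_space1)
  show "(\<lambda>\<rho>. case (m, \<rho>) of (m, \<rho>) \<Rightarrow> (of_nat (card {i. i < m \<and> \<rho> i \<in> A}) :: ennreal))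
      \<in> borel_measurable (Pi\<^sub>M {..<m} (\<lambda>_. restrict_space borel {0..}))"
    unfolding prod.case card_eq_sum_indicator by measurable
qed

text \<open>
  Two families of covers, both driven by a uniform variable \<open>y\<close> on \<open>[0,1]\<close>, are mixed by an independent
  coin that picks the family \<open>True\<close> with probability \<open>p\<close>. This is the only source of
  randomness needed: the expected radii become a weighted sum of the laws of single radii.
\<close>

lemma exists_mixture:
  fixes p :: real and m :: "bool \<Rightarrow> nat" and e :: "bool \<Rightarrow> nat \<Rightarrow> real \<Rightarrow> real"
  assumes p: "0 \<le> p" "p \<le> 1"
    and meas [measurable]: "\<And>b i. e b i \<in> borel_measurable borel"
    and cover: "\<And>b y. y \<in> {0..1} \<Longrightarrow> (m b, \<lambda>i\<in>{..<m b}. e b i y) \<in> short_covers T L"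
  shows "\<exists>\<nu>. prob_space \<nu> \<and> sets \<nu> = sets (restrict_space tuple_space (short_covers T L)) \<and>
    (\<forall>A\<in>sets borel. expected_radii \<nu> A = ennreal
      (p * (\<Sum>i<m True. measure lborel {y \<in> {0..1}. e True i y \<in> A}) +
       (1 - p) * (\<Sum>i<m False. measure lborel {y \<in> {0..1}. e False i y \<in> A})))"
proof -
  let ?S = "restrict_space tuple_space (short_covers T L)"
  define U where "U = restrict_space lborel {0..1::real}"
  define X where "X w = (case w of (b, y) \<Rightarrow> (m b, \<lambda>i\<in>{..<m b}. e b i y))" for w
  let ?B = "measure_pmf (bernoulli_pmf p)"
  let ?M = "?B \<Otimes>\<^sub>M U"
  let ?law = "\<lambda>A b. \<Sum>i<m b. measure lborel {y \<in> {0..1}. e b i y \<in> A}"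
  have space_U: "space U = {0..1}" by (simp add: U_def space_restrict_space)
  interpret U: prob_space U
    by (rule prob_spaceI) (simp add: U_def emeasure_restrict_space space_restrict_space)
  interpret P: pair_prob_space ?B U ..
  have short: "short_covers T L \<subseteq> (SIGMA m:{1..}. {..<m} \<rightarrow>\<^sub>E {0..})"
    by (auto simp: short_covers_def covers_def covers_of_length_def)
  have "(\<lambda>y. X (b, y)) \<in> measurable U tuple_space" for b
  proof -
    have "(m b, \<lambda>i\<in>{..<m b}. e b i y) \<in> (SIGMA m:{1..}. {..<m} \<rightarrow>\<^sub>E {0..})" if "y \<in> {0..1}" for y
      using cover[OF that] short by blast
    then have nonneg: "0 \<le> e b i y" if "y \<in> {0..1}" "i < m b" for i y
      using that by (force simp: PiE_iff)
    have "1 \<le> m b" using cover[of 0 b] short by force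
    have "(\<lambda>y. \<lambda>i\<in>{..<m b}. e b i y)
        \<in> measurable U (Pi\<^sub>M {..<m b} (\<lambda>_. restrict_space borel {0..}))"
      using nonneg unfolding U_def
      by (intro measurable_restrict measurable_restrict_space2 measurable_restrict_space1)
         (auto simp: space_restrict_space)
    from measurable_compose[OF this measurable_Pair_tuple_space[OF \<open>1 \<le> m b\<close>]]
    show ?thesis by (simp add: X_def)
  qed
  then have "X \<in> measurable ?M tuple_space"
    by (subst measurable_cong_sets[OF sets_pair_measure_cong[OF sets_measure_pmf_count_space refl] refl])
       (rule measurable_pair_measure_countable1, auto)
  then have X [measurable]: "X \<in> measurable ?M ?S"
    using cover by (intro measurable_restrict_space2) (auto simp: space_pair_measure space_U X_def)
  show ?thesis
  proof (intro exI[of _ "distr ?M ?S X"] conjI ballI)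
    show "prob_space (distr ?M ?S X)"
      by (rule P.prob_space_distr) (rule X)
    show "sets (distr ?M ?S X) = sets ?S" by simp
  next
    fix A :: "real set" assume A [measurable]: "A \<in> sets borel"
    have count [measurable]:
      "(\<lambda>(m, \<rho>). of_nat (card {i. i < m \<and> \<rho> i \<in> A}) :: ennreal) \<in> borel_measurable ?S"
      by (intro measurable_restrict_space1 measurable_radii_count) simp
    have pos: "0 \<le> ?law A b" for b by (intro sum_nonneg) simp
    have U_law: "emeasure U {y \<in> {0..1}. e b i y \<in> A} =
        ennreal (measure lborel {y \<in> {0..1}. e b i y \<in> A})" for b i
    proof -
      have "{y \<in> {0..1}. e b i y \<in> A} \<in> fmeasurable lborel"
        by (rule fmeasurableI2[of "{0..1}"]) (auto simp: fmeasurable_def emeasure_lborel_Icc_eq)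
      then show ?thesis
        unfolding U_def by (subst emeasure_restrict_space) (auto simp: emeasure_eq_measure2)
    qed
    have inner: "(\<integral>\<^sup>+y. of_nat (card {i. i < m b \<and> (\<lambda>i\<in>{..<m b}. e b i y) i \<in> A}) \<partial>U) =
        ennreal (?law A b)" for b
    proof -
      have "(\<integral>\<^sup>+y. of_nat (card {i. i < m b \<and> (\<lambda>i\<in>{..<m b}. e b i y) i \<in> A}) \<partial>U) =
          (\<integral>\<^sup>+y. (\<Sum>i<m b. indicator {y \<in> {0..1}. e b i y \<in> A} y) \<partial>U)"
        unfolding card_eq_sum_indicator
        by (intro nn_integral_cong sum.cong) (auto simp: space_U indicator_def)
      also have "\<dots> = (\<Sum>i<m b. emeasure U {y \<in> {0..1}. e b i y \<in> A})"
        by (subst nn_integral_sum)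
           (auto simp: U_def sets_restrict_space_iff intro!: borel_measurable_indicator sum.cong nn_integral_indicator)
      also have "\<dots> = ennreal (?law A b)"
        by (simp only: U_law sum_ennreal measure_nonneg)
      finally show ?thesis .
    qed
    have "expected_radii (distr ?M ?S X) A =
        (\<integral>\<^sup>+w. (case X w of (m, \<rho>) \<Rightarrow> of_nat (card {i. i < m \<and> \<rho> i \<in> A})) \<partial>?M)"
      unfolding expected_radii_def by (rule nn_integral_distr[OF X, unfolded measurable_distr_eq1, OF count])
    also have "\<dots> = (\<integral>\<^sup>+b. \<integral>\<^sup>+y. (case X (b, y) of (m, \<rho>) \<Rightarrow> of_nat (card {i. i < m \<and> \<rho> i \<in> A})) \<partial>U \<partial>?B)"
      by (rule U.nn_integral_fst[OF measurable_compose[OF X count], symmetric])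
    also have "\<dots> = (\<integral>\<^sup>+b. ennreal (?law A b) \<partial>?B)"
      by (simp only: X_def prod.case inner)
    also have "\<dots> = ennreal (p * ?law A True + (1 - p) * ?law A False)"
      using p pos by (simp add: ennreal_mult' mult.commute)
    finally show "expected_radii (distr ?M ?S X) A =
        ennreal (p * ?law A True + (1 - p) * ?law A False)" .
  qed
qed

section \<open>Radii bounded by the arm length\<close>

text \<open>
  A first radius followed by alternating ones. Two consecutive later radii sum to \<open>r\<close>, and so do
  two radii at the same later position on arms of different parity; both facts hold for every \<open>y\<close>.
\<close>

definition zigzag :: "real \<Rightarrow> (real \<Rightarrow> real) \<Rightarrow> nat \<Rightarrow> real \<Rightarrow> real" where
  "zigzag r f j y = (if j = 0 then f y else if odd j then r * (1 - y) else r * y)"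

text \<open>
  The left-hand side is the distance from the leaf to the centre of ball \<open>j + 1\<close>. It advances by
  exactly \<open>r\<close> from one ball to the next.
\<close>

lemma zigzag_prefix_sum:
  "2 * (\<Sum>l<Suc j. zigzag r f l y) + zigzag r f (Suc j) y = 2 * f y + (real j + 1) * r - r * y"
proof (induction j)
  case (Suc j)
  have "zigzag r f (Suc j) y + zigzag r f (Suc (Suc j)) y = r"
    by (auto simp: zigzag_def algebra_simps)
  then show ?case using Suc by (simp add: algebra_simps)
qed (simp add: zigzag_def algebra_simps)

text \<open>
  By the previous lemma and the assumption on the total, the centre of ball \<open>j \<ge> 1\<close> is at distance
  \<open>(N - j) r + f (1 - z) - f z + r z\<close> from the centre of the star. The balls of an arm thus keep their
  centres in it as soon as this is nonnegative for \<open>j = N\<close>.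
\<close>

lemma zigzag_short_cover:
  assumes "2 \<le> k" "0 < a" "0 \<le> r" and y: "y \<in> {0..1}"
    and f_nonneg: "\<And>z. z \<in> {0..1} \<Longrightarrow> 0 \<le> f z"
    and gap: "\<And>z. z \<in> {0..1} \<Longrightarrow> f z \<le> f (1 - z) + r * z"
    and total: "\<And>z. z \<in> {0..1} \<Longrightarrow> real N * r + f z + f (1 - z) = a"
  shows "(k * Suc N, \<lambda>i\<in>{..<k * Suc N}. arm_radii (Suc N) (zigzag r f) i y)
    \<in> short_covers (star k a) (star_length k a)"
proof (rule arm_radii_short_cover[OF \<open>2 \<le> k\<close> \<open>0 < a\<close> _ y])
  fix z :: real and j assume z: "z \<in> {0..1}" and j: "j < Suc N"
  show "0 \<le> zigzag r f j z"
    using z f_nonneg[OF z] \<open>0 \<le> r\<close> by (auto simp: zigzag_def)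
  show "0 \<le> a - 2 * (\<Sum>l<j. zigzag r f l z) - zigzag r f j z"
  proof (cases j)
    case 0
    have "0 \<le> real N * r" using \<open>0 \<le> r\<close> by simp
    then show ?thesis
      using 0 total[OF z] f_nonneg[of "1 - z"] z by (simp add: zigzag_def)
  next
    case (Suc i)
    have "real (Suc i) * r \<le> real N * r"
      using j Suc \<open>0 \<le> r\<close> by (intro mult_right_mono) auto
    then show ?thesis
      using zigzag_prefix_sum[of r f z i] gap[OF z] total[OF z] Suc by (simp add: algebra_simps)
  qed
next
  fix z :: real assume z: "z \<in> {0..1}"
  have step: "zigzag r f (Suc j) z + zigzag r f (Suc j) (1 - z) = r" for j
    by (auto simp: zigzag_def algebra_simps)
  have "(\<Sum>j<Suc N. zigzag r f j z + zigzag r f j (1 - z)) = f z + f (1 - z) + (\<Sum>j<N. r)"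
    by (subst sum.lessThan_Suc_shift) (simp add: step, simp add: zigzag_def)
  then show "(\<Sum>j<Suc N. zigzag r f j z) + (\<Sum>j<Suc N. zigzag r f j (1 - z)) = a"
    using total[OF z] by (simp add: sum.distrib)
qed simp

lemma zigzag_law:
  assumes [measurable]: "f \<in> borel_measurable borel" "A \<in> sets borel" and "0 < r"
  shows "(\<Sum>j<Suc N. measure lborel {y \<in> {0..1}. zigzag r f j y \<in> A}) =
    measure lborel {y \<in> {0..1}. f y \<in> A} + real N * (measure lborel (A \<inter> {0..r}) / r)"
proof -
  have law: "measure lborel {y \<in> {0..1}. r * y \<in> A} = measure lborel (A \<inter> {0..r}) / r"
    using measure_affine_preimage[of A r 0] \<open>0 < r\<close> by (simp add: field_simps)
  have "measure lborel {y \<in> {0..1}. zigzag r f (Suc j) y \<in> A} = measure lborel (A \<inter> {0..r}) / r" for j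
    using measure_reflect_preimage[of "\<lambda>y. r * y" A] law
    by (cases "even j") (simp_all add: zigzag_def)
  then show ?thesis
    by (subst sum.lessThan_Suc_shift) (simp add: zigzag_def)
qed

lemma measurable_zigzag:
  assumes [measurable]: "f \<in> borel_measurable borel"
  shows "zigzag r f j \<in> borel_measurable borel"
  unfolding zigzag_def by (cases "j = 0"; cases "odd j") simp_all

lemma measurable_arm_radii:
  assumes [measurable]: "\<And>j. e j \<in> borel_measurable borel"
  shows "arm_radii M e i \<in> borel_measurable borel"
  unfolding arm_radii_def by measurable

lemma zigzag_arms_law:
  assumes [measurable]: "f \<in> borel_measurable borel" "A \<in> sets borel" and "0 < r"
  shows "(\<Sum>i<k * Suc N. measure lborel {y \<in> {0..1}. arm_radii (Suc N) (zigzag r f) i y \<in> A}) =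
    k * (measure lborel {y \<in> {0..1}. f y \<in> A} + real N * (measure lborel (A \<inter> {0..r}) / r))"
  unfolding zigzag_law[OF assms, symmetric]
  by (intro arm_radii_law measurable_zigzag assms)

text \<open>
  The two choices of the first radius, \<open>\<theta> r y\<close> with weight \<open>\<theta>\<close> and \<open>\<theta> r + (1 - \<theta>) r y\<close> with weight
  \<open>1 - \<theta>\<close>, cut \<open>[0,r]\<close> at \<open>\<theta> r\<close> in proportion to the lengths of the pieces. Their mixture is therefore
  uniform on \<open>[0,r]\<close>, like all the other radii.
\<close>

lemma exists_small_radii:
  assumes "2 \<le> k" "0 < r" "r \<le> a"
  shows "\<exists>\<nu>. prob_space \<nu> \<and>
    sets \<nu> = sets (restrict_space tuple_space (short_covers (star k a) (star_length k a))) \<and>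
    (\<forall>A\<in>sets borel. expected_radii \<nu> A = ennreal (k * a / r\<^sup>2 * measure lborel (A \<inter> {0..r})))"
proof -
  define n where "n = nat \<lfloor>a / r\<rfloor>"
  define \<theta> where "\<theta> = a / r - n"
  have "1 \<le> a / r" using assms by simp
  then have "1 \<le> n" unfolding n_def by linarith
  have \<theta>: "0 \<le> \<theta>" "\<theta> \<le> 1" using \<open>1 \<le> a / r\<close> unfolding \<theta>_def n_def by linarith+
  have a: "a = (n + \<theta>) * r" using \<open>0 < r\<close> by (simp add: \<theta>_def)
  define N where "N b = (if b then n else n - 1)" for b
  define s where "s b = (if b then 0 else \<theta> * r)" for b
  define c where "c b = (if b then \<theta> * r else (1 - \<theta>) * r)" for b
  define f where "f b y = s b + c b * y" for b y
  define m where "m b = k * Suc (N b)" for b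
  define e where "e b = arm_radii (Suc (N b)) (zigzag r (f b))" for b
  have f [measurable]: "f b \<in> borel_measurable borel" for b unfolding f_def by measurable
  have cover: "(m b, \<lambda>i\<in>{..<m b}. e b i y) \<in> short_covers (star k a) (star_length k a)"
    if "y \<in> {0..1}" for b y
    unfolding m_def e_def
  proof (rule zigzag_short_cover[OF _ _ _ that])
    fix z :: real assume z: "z \<in> {0..1}"
    show "0 \<le> f b z" using z \<theta> \<open>0 < r\<close> by (auto simp: f_def s_def c_def)
    show "f b z \<le> f b (1 - z) + r * z"
    proof -
      have "0 \<le> \<theta> * (1 - z) + (1 - \<theta>) * z" "0 \<le> (1 - \<theta>) * (1 - z) + \<theta> * z"
        using z \<theta> by (intro add_nonneg_nonneg mult_nonneg_nonneg; simp)+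
      then have "0 \<le> r * (\<theta> * (1 - z) + (1 - \<theta>) * z)" "0 \<le> r * ((1 - \<theta>) * (1 - z) + \<theta> * z)"
        using \<open>0 < r\<close> by simp_all
      then show ?thesis by (cases b) (simp_all add: f_def s_def c_def algebra_simps)
    qed
    show "real (N b) * r + f b z + f b (1 - z) = a"
      using \<open>1 \<le> n\<close> by (cases b) (simp_all add: f_def s_def c_def N_def a of_nat_diff algebra_simps)
  qed (use assms in auto)
  have law: "\<theta> * (\<Sum>i<m True. measure lborel {y \<in> {0..1}. e True i y \<in> A}) +
      (1 - \<theta>) * (\<Sum>i<m False. measure lborel {y \<in> {0..1}. e False i y \<in> A}) =
      k * a / r\<^sup>2 * measure lborel (A \<inter> {0..r})" if [measurable]: "A \<in> sets borel" for A
  proof -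
    let ?\<mu> = "\<lambda>b. measure lborel {y \<in> {0..1}. f b y \<in> A}"
    let ?I = "measure lborel (A \<inter> {0..r})"
    have "\<theta> * r * ?\<mu> True = measure lborel (A \<inter> {0..\<theta> * r})"
      using measure_affine_preimage[of A "\<theta> * r" 0] \<theta> \<open>0 < r\<close> by (simp add: f_def s_def c_def)
    moreover have "(1 - \<theta>) * r * ?\<mu> False = measure lborel (A \<inter> {\<theta> * r..r})"
      using measure_affine_preimage[of A "(1 - \<theta>) * r" "\<theta> * r"] \<theta> \<open>0 < r\<close>
      by (simp add: f_def s_def c_def algebra_simps)
    ultimately have first: "\<theta> * ?\<mu> True + (1 - \<theta>) * ?\<mu> False = ?I / r"
      using measure_Int_split[of A 0 "\<theta> * r" r] \<theta> \<open>0 < r\<close> by (simp add: field_simps)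
    have "\<theta> * (k * (u + n * x)) + (1 - \<theta>) * (k * (v + real (n - 1) * x)) =
        k * ((\<theta> * u + (1 - \<theta>) * v) + (n + \<theta> - 1) * x)" for u v x :: real
      using \<open>1 \<le> n\<close> by (simp add: of_nat_diff algebra_simps)
    then have "\<theta> * (k * (?\<mu> True + n * (?I / r))) + (1 - \<theta>) * (k * (?\<mu> False + real (n - 1) * (?I / r))) =
        k * ((\<theta> * ?\<mu> True + (1 - \<theta>) * ?\<mu> False) + (n + \<theta> - 1) * (?I / r))" .
    also have "\<dots> = k * a / r\<^sup>2 * ?I"
      unfolding first using \<open>0 < r\<close> by (simp add: a field_simps power2_eq_square)
    finally show ?thesis
      unfolding m_def e_def zigzag_arms_law[OF f that \<open>0 < r\<close>] by (simp add: N_def)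
  qed
  have "e b i \<in> borel_measurable borel" for b i
    unfolding e_def by (intro measurable_arm_radii measurable_zigzag f)
  from exists_mixture[where p = \<theta> and m = m and e = e, OF \<theta> this cover]
  obtain \<nu> where \<nu>: "prob_space \<nu>"
    "sets \<nu> = sets (restrict_space tuple_space (short_covers (star k a) (star_length k a)))"
    "\<forall>A\<in>sets borel. expected_radii \<nu> A = ennreal
      (\<theta> * (\<Sum>i<m True. measure lborel {y \<in> {0..1}. e True i y \<in> A}) +
       (1 - \<theta>) * (\<Sum>i<m False. measure lborel {y \<in> {0..1}. e False i y \<in> A}))"
    by blast
  show ?thesis
  proof (intro exI conjI ballI)
    fix A :: "real set" assume A: "A \<in> sets borel"
    show "expected_radii \<nu> A = ennreal (k * a / r\<^sup>2 * measure lborel (A \<inter> {0..r}))"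
      unfolding \<nu>(3)[rule_format, OF A] law[OF A] ..
  qed fact+
qed

section \<open>Radii beyond the arm length\<close>

lemma one_ball_short_cover:
  assumes "0 < k" "0 < a" "a \<le> x" "x \<le> k * a"
  shows "(1, \<lambda>i\<in>{..<1}. x) \<in> short_covers (star k a) (star_length k a)"
proof -
  have "star_points k a \<subseteq> mcball_of (star k a) (0, 0) x"
    using assms by (auto simp: star_points_def star_dist_def)
  then have "(1, \<lambda>i\<in>{..<1}. x) \<in> covers (star k a)"
    using assms unfolding covers_def covers_of_length_def
    by (auto intro!: bexI[of _ "\<lambda>_. (0, 0)"] simp: star_points_def)
  then show ?thesis using assms by (simp add: short_covers_def star_length_def)
qed

text \<open>
  One ball with radius above \<open>a\<close> replaces the \<open>k\<close> balls below \<open>a\<close> of a folded cover. The single ball is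
  used as often as the density \<open>D\<close> on \<open>[a,r]\<close> permits.
\<close>

lemma exists_large_radii:
  assumes "2 \<le> k" "0 < a" "a < r" "r \<le> (real k - 1) * a"
  shows "\<exists>\<nu>. prob_space \<nu> \<and>
    sets \<nu> = sets (restrict_space tuple_space (short_covers (star k a) (star_length k a))) \<and>
    (\<forall>A\<in>sets borel. expected_radii \<nu> A \<le> ennreal (k * a / r\<^sup>2 * measure lborel (A \<inter> {0..r})))"
proof -
  define D where "D = k * a / r\<^sup>2"
  define p where "p = min 1 (D * (r - a))"
  have "0 < r" "0 < D" using assms by (auto simp: D_def)
  have p: "0 \<le> p" "p \<le> 1" using \<open>0 < D\<close> assms by (auto simp: p_def)
  have weight1: "p \<le> D * (r - a)" by (simp add: p_def)
  have weight2: "(1 - p) * k \<le> D * a"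
  proof (cases "1 \<le> D * (r - a)")
    case True
    then show ?thesis using \<open>0 < D\<close> \<open>0 < a\<close> by (simp add: p_def)
  next
    case False
    (* Multiplied by k (r - a) / r^2, the inequality r + a <= k a becomes k <= D a + k D (r - a). *)
    have "(r - a) * (r + a) \<le> (r - a) * (k * a)"
      using assms by (intro mult_left_mono) (auto simp: algebra_simps)
    then have "k * r\<^sup>2 \<le> k * (a\<^sup>2 + k * a * (r - a))"
      by (intro mult_left_mono) (auto simp: algebra_simps power2_eq_square)
    then have "k \<le> D * a + k * (D * (r - a))"
      using \<open>0 < r\<close> by (simp add: D_def field_simps power2_eq_square)
    then show ?thesis using False by (simp add: p_def algebra_simps)
  qed
  define m where "m b = (if b then 1 else k)" for b
  define e where "e b i y = (if b then a + (r - a) * y else arm_radii 1 (\<lambda>_ y. a * y) i y)"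
    for b :: bool and i :: nat and y :: real
  have cover: "(m b, \<lambda>i\<in>{..<m b}. e b i y) \<in> short_covers (star k a) (star_length k a)"
    if y: "y \<in> {0..1}" for b y
  proof (cases b)
    case True
    have "0 \<le> (r - a) * y" "(r - a) * y \<le> r - a"
      using y assms by (auto intro: mult_left_le)
    then show ?thesis
      using True one_ball_short_cover[of k a "a + (r - a) * y"] assms
      by (simp add: m_def e_def algebra_simps)
  next
    case False
    have "(k * 1, \<lambda>i\<in>{..<k * 1}. arm_radii 1 (\<lambda>_ y. a * y) i y)
        \<in> short_covers (star k a) (star_length k a)"
      using assms y by (intro arm_radii_short_cover) (auto simp: mult_left_le algebra_simps)
    then show ?thesis using False by (simp add: m_def e_def)
  qed
  have law: "p * (\<Sum>i<m True. measure lborel {y \<in> {0..1}. e True i y \<in> A}) +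
      (1 - p) * (\<Sum>i<m False. measure lborel {y \<in> {0..1}. e False i y \<in> A})
      \<le> D * measure lborel (A \<inter> {0..r})" if [measurable]: "A \<in> sets borel" for A
  proof -
    let ?I = "measure lborel (A \<inter> {0..a})" and ?J = "measure lborel (A \<inter> {a..r})"
    have "(\<Sum>i<m True. measure lborel {y \<in> {0..1}. e True i y \<in> A}) = ?J / (r - a)"
      using measure_affine_preimage[of A "r - a" a] \<open>a < r\<close> by (simp add: m_def e_def field_simps)
    then have "p * (\<Sum>i<m True. measure lborel {y \<in> {0..1}. e True i y \<in> A}) \<le> D * ?J"
      using weight1 \<open>a < r\<close> mult_right_mono[OF weight1, of "?J / (r - a)"] by simp
    moreover have "measure lborel {y \<in> {0..1}. a * y \<in> A} = ?I / a"
      using measure_affine_preimage[of A a 0] \<open>0 < a\<close> by (simp add: field_simps)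
    then have "(\<Sum>i<m False. measure lborel {y \<in> {0..1}. e False i y \<in> A}) = k * (?I / a)"
      using arm_radii_law[of "\<lambda>_ y. a * y" A 1 k] by (simp add: m_def e_def)
    then have "(1 - p) * (\<Sum>i<m False. measure lborel {y \<in> {0..1}. e False i y \<in> A}) \<le> D * ?I"
      using \<open>0 < a\<close> mult_right_mono[OF weight2, of "?I / a"] by simp
    moreover have "D * ?I + D * ?J = D * measure lborel (A \<inter> {0..r})"
      unfolding distrib_left[symmetric] using measure_Int_split[of A 0 a r] assms by simp
    ultimately show ?thesis by linarith
  qed
  have "e b i \<in> borel_measurable borel" for b i
    unfolding e_def by (cases b) (simp_all add: measurable_arm_radii)
  from exists_mixture[where p = p and m = m and e = e, OF p this cover]
  obtain \<nu> where \<nu>: "prob_space \<nu>"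
    "sets \<nu> = sets (restrict_space tuple_space (short_covers (star k a) (star_length k a)))"
    "\<forall>A\<in>sets borel. expected_radii \<nu> A = ennreal
      (p * (\<Sum>i<m True. measure lborel {y \<in> {0..1}. e True i y \<in> A}) +
       (1 - p) * (\<Sum>i<m False. measure lborel {y \<in> {0..1}. e False i y \<in> A}))"
    by blast
  show ?thesis
  proof (intro exI conjI ballI)
    fix A :: "real set" assume A: "A \<in> sets borel"
    show "expected_radii \<nu> A \<le> ennreal (k * a / r\<^sup>2 * measure lborel (A \<inter> {0..r}))"
      unfolding \<nu>(3)[rule_format, OF A] D_def[symmetric] by (intro ennreal_leI law A)
  qed fact+
qed

section \<open>Necessity of the bound\<close>

text \<open>
  Two leaves are at distance \<open>2 a\<close>, so if all radii are below \<open>a\<close> then sending each leaf to a ball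
  that contains it is injective. The factor \<open>k\<close> lets one large radius stand for \<open>k\<close> small ones.
\<close>

lemma many_radii:
  assumes "0 < a" and "(m, \<rho>) \<in> covers (star k a)"
  shows "k \<le> k * card {i. i < m \<and> \<rho> i \<in> {a..}} + card {i. i < m \<and> \<rho> i \<in> {0..<a}}"
proof (cases "\<exists>i<m. a \<le> \<rho> i")
  case True
  then have "1 \<le> card {i. i < m \<and> \<rho> i \<in> {a..}}"
    by (auto simp: Suc_le_eq card_gt_0_iff)
  from mult_le_mono2[OF this, of k] show ?thesis
    unfolding mult_1_right by (rule trans_le_add1)
next
  case False
  from assms(2) obtain v where cov: "star_points k a \<subseteq> (\<Union>i<m. mcball_of (star k a) (v i) (\<rho> i))"
    and nonneg: "\<And>i. i < m \<Longrightarrow> 0 \<le> \<rho> i"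
    by (auto simp: covers_def covers_of_length_def PiE_iff)
  have "\<exists>i<m. star_dist (v i) (q, a) \<le> \<rho> i" if "q < k" for q
  proof -
    have "(q, a) \<in> star_points k a" using that \<open>0 < a\<close> by (auto simp: star_points_def)
    with cov show ?thesis by force
  qed
  then obtain h where h: "\<And>q. q < k \<Longrightarrow> h q < m \<and> star_dist (v (h q)) (q, a) \<le> \<rho> (h q)"
    by metis
  have "inj_on h {..<k}"
  proof (rule inj_onI, rule ccontr)
    fix q q' assume q: "q \<in> {..<k}" "q' \<in> {..<k}" "h q = h q'" "q \<noteq> q'"
    have "2 * a \<le> star_dist (v (h q)) (q, a) + star_dist (v (h q)) (q', a)"
      using \<open>0 < a\<close> q by (auto simp: star_dist_def)
    also have "\<dots> \<le> 2 * \<rho> (h q)" using h[of q] h[of q'] q by simp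
    finally show False using False h[of q] q by auto
  qed
  then have "k = card (h ` {..<k})" by (simp add: card_image)
  also have "\<dots> \<le> card {i. i < m \<and> \<rho> i \<in> {0..<a}}"
    using h nonneg False by (intro card_mono) (auto simp: not_le)
  finally show ?thesis by simp
qed

text \<open>
  The inequality of \<open>many_radii\<close> is integrated over \<open>\<nu>\<close>. It is tight for the optimal measures,
  whose covers have either one radius, at least \<open>a\<close>, or exactly \<open>k\<close> radii, all below \<open>a\<close>; this is why
  the bound obtained is the exact threshold.
\<close>

lemma radius_bound_necessary:
  assumes "2 \<le> k" "0 < a" "0 < r" and \<nu>: "prob_space \<nu>"
    and sets_\<nu>: "sets \<nu> = sets (restrict_space tuple_space (short_covers (star k a) L))"
    and bound: "\<And>A. A \<in> sets borel \<Longrightarrow> A \<subseteq> {0..} \<Longrightarrow>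
      expected_radii \<nu> A \<le> ennreal (k * a / r\<^sup>2 * measure lborel (A \<inter> {0..r}))"
  shows "r \<le> (real k - 1) * a"
proof (rule ccontr)
  assume contr: "\<not> r \<le> (real k - 1) * a"
  have "1 * a \<le> (real k - 1) * a" using assms by (intro mult_right_mono) auto
  then have "a < r" using contr by simp
  interpret prob_space \<nu> by fact
  define count :: "real set \<Rightarrow> nat \<times> (nat \<Rightarrow> real) \<Rightarrow> ennreal"
    where "count A = (\<lambda>(m, \<rho>). of_nat (card {i. i < m \<and> \<rho> i \<in> A}))" for A
  have expected: "expected_radii \<nu> A = (\<integral>\<^sup>+w. count A w \<partial>\<nu>)" for A
    by (simp add: expected_radii_def count_def)
  have space: "space \<nu> \<subseteq> short_covers (star k a) L"
    using sets_eq_imp_space_eq[OF sets_\<nu>] by (auto simp: space_restrict_space)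
  have count [measurable]: "count A \<in> borel_measurable \<nu>" if "A \<in> sets borel" for A
    unfolding measurable_cong_sets[OF sets_\<nu> refl] count_def
    by (intro measurable_restrict_space1 measurable_radii_count that)
  have large: "{a..} \<inter> {0..r} = {a..r}" and small: "{0..<a} \<inter> {0..r} = {0..<a}"
    using \<open>0 < a\<close> \<open>a < r\<close> by auto
  have "of_nat k = (\<integral>\<^sup>+w. of_nat k \<partial>\<nu>)" by (simp add: emeasure_space_1)
  also have "\<dots> \<le> (\<integral>\<^sup>+w. of_nat k * count {a..} w + count {0..<a} w \<partial>\<nu>)"
  proof (intro nn_integral_mono)
    fix w assume "w \<in> space \<nu>"
    then obtain m \<rho> where w: "w = (m, \<rho>)" "(m, \<rho>) \<in> covers (star k a)"
      using space by (auto simp: short_covers_def)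
    show "of_nat k \<le> of_nat k * count {a..} w + count {0..<a} w"
      using many_radii[OF \<open>0 < a\<close> w(2)] unfolding w(1) count_def prod.case
      by (simp only: of_nat_mult[symmetric] of_nat_add[symmetric] of_nat_le_iff)
  qed
  also have "\<dots> = (\<integral>\<^sup>+w. of_nat k * count {a..} w \<partial>\<nu>) + (\<integral>\<^sup>+w. count {0..<a} w \<partial>\<nu>)"
    by (rule nn_integral_add; measurable)
  also have "(\<integral>\<^sup>+w. of_nat k * count {a..} w \<partial>\<nu>) = of_nat k * (\<integral>\<^sup>+w. count {a..} w \<partial>\<nu>)"
    by (intro nn_integral_cmult count) auto
  also have "of_nat k * (\<integral>\<^sup>+w. count {a..} w \<partial>\<nu>) + (\<integral>\<^sup>+w. count {0..<a} w \<partial>\<nu>) \<le>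
      of_nat k * ennreal (k * a / r\<^sup>2 * measure lborel ({a..} \<inter> {0..r}))
      + ennreal (k * a / r\<^sup>2 * measure lborel ({0..<a} \<inter> {0..r}))"
    unfolding expected[symmetric] using \<open>0 < a\<close>
    by (intro add_mono mult_left_mono bound) auto
  also have "\<dots> = ennreal (k * (k * a / r\<^sup>2 * (r - a)) + k * a / r\<^sup>2 * a)"
    using \<open>0 < a\<close> \<open>a < r\<close> unfolding large small
    by (simp add: ennreal_mult[symmetric] ennreal_of_nat_eq_real_of_nat)
  finally have "real k \<le> k * (k * a / r\<^sup>2 * (r - a)) + k * a / r\<^sup>2 * a"
    using \<open>0 < a\<close> \<open>a < r\<close> by (simp add: ennreal_of_nat_eq_real_of_nat del: ennreal_plus)
  then have "real k * r\<^sup>2 \<le> real k * (k * a * (r - a) + a\<^sup>2)"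
    using \<open>0 < r\<close> by (simp add: field_simps power2_eq_square)
  then have "r\<^sup>2 \<le> k * a * (r - a) + a\<^sup>2"
    using \<open>2 \<le> k\<close> by (subst (asm) mult_le_cancel_left_pos) auto
  then have "(r - a) * (r + a) \<le> (r - a) * (k * a)"
    by (simp add: algebra_simps power2_eq_square)
  then have "r + a \<le> k * a" using \<open>a < r\<close> by simp
  then show False using contr by (simp add: algebra_simps)
qed

section \<open>The threshold\<close>

lemma scaled_uniform_measure:
  assumes [measurable]: "A \<in> sets borel" and "0 < r" "0 \<le> c"
  shows "ennreal (c / r) * emeasure (uniform_measure lborel {0..r}) A =
    ennreal (c / r\<^sup>2 * measure lborel (A \<inter> {0..r}))"
proof -
  have "A \<inter> {0..r} \<in> fmeasurable lborel"
    by (rule fmeasurableI2[of "{0..r}"]) (auto simp: fmeasurable_def emeasure_lborel_Icc_eq)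
  then have "emeasure lborel (A \<inter> {0..r}) = ennreal (measure lborel (A \<inter> {0..r}))"
    by (rule emeasure_eq_measure2)
  then show ?thesis
    using assms(2,3) by (simp add: Int_commute divide_ennreal ennreal_mult[symmetric] power2_eq_square)
qed

theorem theorem5p7:
  fixes k :: nat and a r :: real
  assumes "k \<ge> 2" and "a > 0" and "r > 0"
  shows "(\<exists>\<nu>. prob_space \<nu> \<and>
            sets \<nu> = sets (restrict_space tuple_space
                            (short_covers (star k a) (star_length k a))) \<and>
            (\<forall>A \<in> sets (restrict_space borel {0..}).
               expected_radii \<nu> A \<le>
                 ennreal (real k * a / r) * emeasure (uniform_measure lborel {0..r}) A))
         \<longleftrightarrow> 0 < r \<and> r \<le> (real k - 1) * a"
proof -
  have borel: "A \<in> sets (restrict_space borel {0..}) \<longleftrightarrow> A \<in> sets borel \<and> A \<subseteq> {0..}"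
    for A :: "real set" by (auto simp: sets_restrict_space_iff)
  have rhs: "ennreal (real k * a / r) * emeasure (uniform_measure lborel {0..r}) A =
      ennreal (k * a / r\<^sup>2 * measure lborel (A \<inter> {0..r}))" if "A \<in> sets borel" for A
    using scaled_uniform_measure[OF that \<open>r > 0\<close>, of "k * a"] \<open>a > 0\<close> by simp
  show ?thesis (is "?E \<longleftrightarrow> ?R")
  proof
    assume ?E
    then obtain \<nu> where "prob_space \<nu>"
      "sets \<nu> = sets (restrict_space tuple_space (short_covers (star k a) (star_length k a)))"
      "\<And>A. A \<in> sets borel \<Longrightarrow> A \<subseteq> {0..} \<Longrightarrow>
        expected_radii \<nu> A \<le> ennreal (k * a / r\<^sup>2 * measure lborel (A \<inter> {0..r}))"
      using rhs borel by metis
    from radius_bound_necessary[OF assms this] show ?R using \<open>r > 0\<close> by simp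
  next
    assume R: ?R
    have "\<exists>\<nu>. prob_space \<nu> \<and>
      sets \<nu> = sets (restrict_space tuple_space (short_covers (star k a) (star_length k a))) \<and>
      (\<forall>A\<in>sets borel. expected_radii \<nu> A \<le> ennreal (k * a / r\<^sup>2 * measure lborel (A \<inter> {0..r})))"
    proof (cases "r \<le> a")
      case True
      from exists_small_radii[OF assms(1,3) True] show ?thesis by (metis order_refl)
    next
      case False
      with R exists_large_radii[of k a r] assms show ?thesis by simp
    qed
    then show ?E by (elim exE conjE) (auto simp: borel rhs simp del: emeasure_uniform_measure)
  qed
qed

end
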